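(* Let $a,b,c\in\mathbb{R}$ with $a\neq 0$, let $g:\mathbb{R}\to\mathbb{R}$, $g(x)=ax^2+bx+c$, let $\delta:=b^2-4ac-2b-7$, and assume $\delta\geq 0$. Then the points of the 3-cycle $\mathcal{C}_{\langle\delta\rangle}$, respectively $\mathcal{C}_{\langle-\delta\rangle}$, of the map $x_{t+1}=g(x_t)$ are the roots of the cubic polynomial $R_{\delta}$, respectively $R_{-\delta}$, where $$R_{\pm\delta}(X)=X^3+c^{\langle\pm\delta\rangle}_2X^2+c^{\langle\pm\delta\rangle}_1X+c^{\langle\pm\delta\rangle}_0,$$ with (upper signs for $R_\delta$, lower signs for $R_{-\delta}$) $$c^{\langle\pm\delta\rangle}_2=\frac{1}{2a}\left(3b+1\mp\sqrt{\delta}\right),$$ $$c^{\langle\pm\delta\rangle}_1=\frac{1}{4a^2}\left(3b^2+2b-9-\delta\mp2(b+1)\sqrt{\delta}\right),$$ $$c^{\langle\pm\delta\rangle}_0=\frac{1}{8a^3}\left(\pm\sqrt{\delta^3}+(1-b)\delta\mp(b^2+2b-7)\sqrt{\delta}+b^3+b^2-9b-1\right).$$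
   Context: A 3-cycle of the map $x_{t+1}=g(x_t)$ is the class, modulo cyclic permutation, of an ordered triple $(x,y,z)$ of pairwise distinct real numbers with $g(x)=y$, $g(y)=z$, $g(z)=x$; its points are $x,y,z$. For $\beta\in\mathbb{R}$ let $Q_\beta(X)=X^3+(1-\beta)X^2-(2+\beta)X-1$. All roots of $Q_\beta$ are real, distinct and nonzero; they are denoted $q^{\langle\beta\rangle}_1<q^{\langle\beta\rangle}_2<q^{\langle\beta\rangle}_3$. For $\delta=0$ the map has a unique 3-cycle $\mathcal{C}_{\langle0\rangle}$, whose points are $\frac{-b+1}{2a}+\frac{1}{a q^{\langle0\rangle}_i}$, $i\in\{1,2,3\}$ (in this case $\mathcal{C}_{\langle\delta\rangle}=\mathcal{C}_{\langle-\delta\rangle}=\mathcal{C}_{\langle0\rangle}$). For $\delta>0$ the map has exactly two 3-cycles: $\mathcal{C}_{\langle\delta\rangle}$, whose points are $\frac{-b+\sqrt{\delta}+1}{2a}+\frac{1}{a q^{\langle\sqrt{\delta}\rangle}_i}$, and $\mathcal{C}_{\langle-\delta\rangle}$, whose points are $\frac{-b-\sqrt{\delta}+1}{2a}+\frac{1}{a q^{\langle-\sqrt{\delta}\rangle}_i}$, $i\in\{1,2,3\}$. *)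

theory Defs
  imports "HOL-Computational_Algebra.Polynomial" Complex_Main
begin

definition cyclic_class :: "real \<Rightarrow> real \<Rightarrow> real \<Rightarrow> (real \<times> real \<times> real) set" where
  "cyclic_class x y z = {(x, y, z), (y, z, x), (z, x, y)}"

definition three_cycles :: "(real \<Rightarrow> real) \<Rightarrow> (real \<times> real \<times> real) set set" where
  "three_cycles g =
     {cyclic_class x y z | x y z. x \<noteq> y \<and> y \<noteq> z \<and> z \<noteq> x \<and> g x = y \<and> g y = z \<and> g z = x}"

definition cycle_points :: "(real \<times> real \<times> real) set \<Rightarrow> real set" where
  "cycle_points C = (\<Union>(x, y, z)\<in>C. {x, y, z})"

definition Q_poly :: "real \<Rightarrow> real poly" where
  "Q_poly \<beta> = [:- 1, - (2 + \<beta>), 1 - \<beta>, 1:]"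

text \<open>For \<open>i \<in> {1, 2, 3}\<close>: the \<open>i\<close>-th smallest root of \<open>Q_poly \<beta>\<close>.\<close>

definition q_root :: "real \<Rightarrow> nat \<Rightarrow> real" where
  "q_root \<beta> i = sorted_list_of_set {x. poly (Q_poly \<beta>) x = 0} ! (i - 1)"

text \<open>
  The sign \<open>\<sigma>\<close> selects between the two objects: \<open>\<sigma> = 1\<close> gives the cycle and the cubic
  labelled by \<open>\<delta>\<close>, and \<open>\<sigma> = - 1\<close> those labelled by \<open>- \<delta>\<close>. For \<open>\<delta> = 0\<close> the two signs agree.
  The definite description in \<open>C_cycle\<close> is justified by \<open>C_cycle_well_defined\<close> below.
\<close>

definition cycle_pts_formula :: "real \<Rightarrow> real \<Rightarrow> real \<Rightarrow> real \<Rightarrow> real set" where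
  "cycle_pts_formula a b \<delta> \<sigma> =
     (\<lambda>i. (- b + \<sigma> * sqrt \<delta> + 1) / (2 * a) + 1 / (a * q_root (\<sigma> * sqrt \<delta>) i)) ` {1, 2, 3}"

definition C_cycle :: "(real \<Rightarrow> real) \<Rightarrow> real \<Rightarrow> real \<Rightarrow> real \<Rightarrow> real \<Rightarrow> (real \<times> real \<times> real) set" where
  "C_cycle g a b \<delta> \<sigma> =
     (THE C. C \<in> three_cycles g \<and> cycle_points C = cycle_pts_formula a b \<delta> \<sigma>)"

definition R_poly :: "real \<Rightarrow> real \<Rightarrow> real \<Rightarrow> real \<Rightarrow> real poly" where
  "R_poly a b \<delta> \<sigma> =
     [:(\<sigma> * sqrt (\<delta> ^ 3) + (1 - b) * \<delta> - \<sigma> * (b\<^sup>2 + 2 * b - 7) * sqrt \<delta>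
          + b ^ 3 + b\<^sup>2 - 9 * b - 1) / (8 * a ^ 3),
       (3 * b\<^sup>2 + 2 * b - 9 - \<delta> - \<sigma> * 2 * (b + 1) * sqrt \<delta>) / (4 * a\<^sup>2),
       (3 * b + 1 - \<sigma> * sqrt \<delta>) / (2 * a),
       1:]"

lemma three_cycle_eq_image:
  assumes "C \<in> three_cycles g"
  shows "C = (\<lambda>u. (u, g u, g (g u))) ` cycle_points C"
  using assms unfolding three_cycles_def cycle_points_def cyclic_class_def by force

lemma Q_poly_roots:
  obtains x y z where "x < y" "y < z" "{u. poly (Q_poly \<beta>) u = 0} = {x, y, z}"
    "x \<noteq> 0" "y \<noteq> 0" "z \<noteq> 0" "x = - 1 - 1 / z" "y = - 1 - 1 / x" "z = - 1 - 1 / y"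
proof -
  let ?f = "poly (Q_poly \<beta>)"
  have f: "?f u = u ^ 3 + (1 - \<beta>) * u\<^sup>2 - (2 + \<beta>) * u - 1" for u
    by (simp add: Q_poly_def algebra_simps power2_eq_square power3_eq_cube)
  define M where "M = 4 + \<bar>\<beta>\<bar>"
  have M: "0 < M" by (simp add: M_def)
  have top: "?f M > 0"
  proof -
    have "?f M = M\<^sup>2 * (M - \<beta> - 3) + (M - 1) * (4 * M) + (2 - \<beta>) * M - 1"
      unfolding f by (simp add: algebra_simps power2_eq_square power3_eq_cube)
    moreover have "M\<^sup>2 * (M - \<beta> - 3) \<ge> 0" by (simp add: M_def)
    moreover have "(M - 1) * (4 * M) + (2 - \<beta>) * M - 1 = M * (4 * M - 2 - \<beta>) - 1"
      by (simp add: algebra_simps)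
    moreover have "M * (4 * M - 2 - \<beta>) \<ge> 1 * 2"
      by (rule mult_mono) (auto simp: M_def)
    ultimately show ?thesis by linarith
  qed
  have "?f 0 < 0" by (simp add: f)
  then obtain z where z: "0 < z" "?f z = 0"
    using poly_IVT_pos[OF M _ top] by blast
  define x where "x = - 1 - 1 / z"
  define y where "y = - 1 - 1 / x"
  have xn: "x < - 1" using z by (simp add: x_def)
  have yb: "- 1 < y" "y < 0" using xn by (auto simp: y_def divide_simps)
  have step: "?f (- 1 - 1 / u) = 0" if "?f u = 0" "u \<noteq> 0" for u
  proof -
    have "u ^ 3 * ?f (- 1 - 1 / u) = ?f u"
      using that(2) unfolding f by (simp add: field_simps power2_eq_square power3_eq_cube)
    thus ?thesis using that by simp
  qed
  have fx: "?f x = 0" using step[of z] z by (simp add: x_def)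
  have fy: "?f y = 0" using step[of x] fx xn by (simp add: y_def)
  have zy: "z = - 1 - 1 / y"
  proof -
    have "x * z = - (z + 1)" "y * x = - (x + 1)"
      using z xn by (auto simp: x_def y_def field_simps)
    hence "x * (y * z + y + 1) = 0" by algebra
    hence "y * z + y + 1 = 0" using xn by simp
    thus ?thesis using yb by (simp add: field_simps)
  qed
  have "Q_poly \<beta> \<noteq> 0" "degree (Q_poly \<beta>) = 3" by (simp_all add: Q_poly_def)
  hence "card {u. ?f u = 0} \<le> 3" "finite {u. ?f u = 0}"
    using card_poly_roots_bound[of "Q_poly \<beta>"] poly_roots_finite[of "Q_poly \<beta>"] by auto
  moreover have "card {x, y, z} = 3" using xn yb z by auto
  moreover have "{x, y, z} \<subseteq> {u. ?f u = 0}" using fx fy z by auto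
  ultimately have "{u. ?f u = 0} = {x, y, z}"
    by (metis card_seteq)
  moreover have "x < y" "y < z" "x \<noteq> 0" "y \<noteq> 0" "z \<noteq> 0" using xn yb z by linarith+
  ultimately show ?thesis using that x_def y_def zy by blast
qed

lemma C_cycle_well_defined:
  fixes a b c \<delta> \<sigma> :: real and g :: "real \<Rightarrow> real"
  assumes a: "a \<noteq> 0"
    and g: "\<And>x. g x = a * x\<^sup>2 + b * x + c"
    and \<delta>: "\<delta> = b\<^sup>2 - 4 * a * c - 2 * b - 7" "\<delta> \<ge> 0"
    and \<sigma>: "\<sigma> = 1 \<or> \<sigma> = - 1"
  shows "\<exists>!C. C \<in> three_cycles g \<and> cycle_points C = cycle_pts_formula a b \<delta> \<sigma>"
proof (rule ex_ex1I)
  define s where "s = \<sigma> * sqrt \<delta>"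
  have s2: "s\<^sup>2 = b\<^sup>2 - 4 * a * c - 2 * b - 7"
    using \<delta> \<sigma> by (auto simp: s_def)
  obtain x y z where r: "x < y" "y < z" "{u. poly (Q_poly s) u = 0} = {x, y, z}"
    "x \<noteq> 0" "y \<noteq> 0" "z \<noteq> 0" "x = - 1 - 1 / z" "y = - 1 - 1 / x" "z = - 1 - 1 / y"
    using Q_poly_roots by blast
  define p where "p u = (- b + s + 1) / (2 * a) + 1 / (a * u)" for u
  have "sorted_list_of_set {x, y, z} = [x, y, z]"
    using r(1,2) by (auto simp: sorted_list_of_set_insert_remove)
  hence pts: "cycle_pts_formula a b \<delta> \<sigma> = {p x, p y, p z}"
    by (simp add: cycle_pts_formula_def q_root_def r(3) p_def flip: s_def)
  have c: "c = (b\<^sup>2 - 2 * b - 7 - s\<^sup>2) / (4 * a)" using s2 a by (simp add: field_simps)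
  have gp: "g (p u) = p v"
    if u: "u \<in> {x, y, z}" "u \<noteq> 0" and v: "v = - 1 - 1 / u" "v \<noteq> 0" for u v
  proof -
    define t where "t = 1 / u"
    have "poly (Q_poly s) u = 0" using u r(3) by blast
    hence q: "u ^ 3 + (1 - s) * u\<^sup>2 - (2 + s) * u - 1 = 0"
      by (simp add: Q_poly_def algebra_simps power2_eq_square power3_eq_cube)
    have ut: "u * t = 1" using u by (simp add: t_def)
    have q': "1 + (1 - s) * t - (2 + s) * t\<^sup>2 - t ^ 3 = 0" using q ut by algebra
    have t1: "1 + t \<noteq> 0" using v by (auto simp: t_def)
    have "(t\<^sup>2 + (s + 1) * t - 2) * (1 + t) = - 1" using q' by algebra
    hence iv: "1 / v = t\<^sup>2 + (s + 1) * t - 2"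
    proof -
      assume h: "(t\<^sup>2 + (s + 1) * t - 2) * (1 + t) = - 1"
      have "v = - (1 + t)" using v by (simp add: t_def)
      with h have "(t\<^sup>2 + (s + 1) * t - 2) * v = 1" by algebra
      thus ?thesis using v(2) by (simp add: field_simps)
    qed
    have pu: "p u = (- b + s + 1 + 2 * t) / (2 * a)" using a u by (simp add: p_def t_def field_simps)
    have pv: "p v = (- b + s + 1 + 2 * (t\<^sup>2 + (s + 1) * t - 2)) / (2 * a)"
      unfolding iv[symmetric] using a v(2) by (simp add: p_def field_simps)
    show ?thesis unfolding g pu pv c using a
      by (simp add: field_simps power2_eq_square)
  qed
  have "p u \<noteq> p v" if "u \<noteq> v" "u \<noteq> 0" "v \<noteq> 0" for u v
    using that a by (simp add: p_def field_simps)
  moreover have "x \<noteq> y" "y \<noteq> z" "z \<noteq> x" using r(1,2) by linarith+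
  ultimately have "p x \<noteq> p y" "p y \<noteq> p z" "p z \<noteq> p x" using r(4,5,6) by blast+
  moreover have "g (p x) = p y" by (rule gp) (use r(4,5,8) in blast)+
  moreover have "g (p y) = p z" by (rule gp) (use r(5,6,9) in blast)+
  moreover have "g (p z) = p x" by (rule gp) (use r(4,6,7) in blast)+
  ultimately have "cyclic_class (p x) (p y) (p z) \<in> three_cycles g"
    unfolding three_cycles_def by blast
  moreover have "cycle_points (cyclic_class (p x) (p y) (p z)) = {p x, p y, p z}"
    by (auto simp: cycle_points_def cyclic_class_def)
  ultimately show "\<exists>C. C \<in> three_cycles g \<and> cycle_points C = cycle_pts_formula a b \<delta> \<sigma>"
    using pts by auto
next
  fix C D
  assume "C \<in> three_cycles g \<and> cycle_points C = cycle_pts_formula a b \<delta> \<sigma>"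
    and "D \<in> three_cycles g \<and> cycle_points D = cycle_pts_formula a b \<delta> \<sigma>"
  thus "C = D" using three_cycle_eq_image by metis
qed

end

theory Submission
  imports Defs
begin

text \<open>
  Put \<open>s = \<sigma> * sqrt \<delta>\<close>. The points of the cycle are the images of the roots \<open>u\<close> of \<open>Q_poly s\<close>
  under \<open>u \<mapsto> (1 - b + s + 2 * t) / (2 * a)\<close> with \<open>t = 1 / u\<close>. Hence they are the roots of the cubic
  obtained from the reciprocal polynomial of \<open>Q_poly s\<close> by this affine substitution,
  and that cubic is, up to a constant factor, \<open>R_poly a b \<delta> \<sigma>\<close>.
\<close>

lemma cycle_pts_formula_eq_image:
  "cycle_pts_formula a b \<delta> \<sigma> =
     (\<lambda>u. (- b + \<sigma> * sqrt \<delta> + 1) / (2 * a) + 1 / (a * u)) ` {u. poly (Q_poly (\<sigma> * sqrt \<delta>)) u = 0}"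
proof -
  obtain x y z where r: "x < y" "y < z" "{u. poly (Q_poly (\<sigma> * sqrt \<delta>)) u = 0} = {x, y, z}"
    by (rule Q_poly_roots) (rule that)
  \<comment> \<open>The sorted list has exactly three entries, so the indices 1, 2, 3 in
    \<open>q_root\<close> run through all roots and their order no longer matters.\<close>
  have "sorted_list_of_set {x, y, z} = [x, y, z]"
    using r(1,2) by (auto simp: sorted_list_of_set_insert_remove)
  then show ?thesis
    by (simp add: cycle_pts_formula_def q_root_def r(3))
qed

text \<open>The coefficient denominators are graded by powers of \<open>2 * a\<close>, so at
  \<open>m / (2 * a)\<close> every term gets the denominator \<open>8 * a ^ 3\<close>, which the
  prefactor clears.\<close>

lemma poly_cubic_rescaled:
  fixes a :: real
  assumes "a \<noteq> 0"
  shows "8 * (a ^ 3 * poly [:k\<^sub>0 / (8 * a ^ 3), k\<^sub>1 / (4 * a\<^sup>2), k\<^sub>2 / (2 * a), 1:] (m / (2 * a))) =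
         k\<^sub>0 + k\<^sub>1 * m + k\<^sub>2 * m\<^sup>2 + m ^ 3"
  using assms by (simp add: field_simps power2_eq_square power3_eq_cube)

text \<open>Since \<open>\<sigma>\<close> squares to 1, \<open>\<delta>\<close> is the square of
  \<open>s\<close>; both signs then reduce to one polynomial identity in \<open>b\<close>,
  \<open>s\<close> and \<open>t\<close>.\<close>

lemma poly_R_poly_affine:
  assumes "a \<noteq> 0" "\<delta> \<ge> 0" "\<sigma> = 1 \<or> \<sigma> = - 1"
  defines "s \<equiv> \<sigma> * sqrt \<delta>"
  shows "a ^ 3 * poly (R_poly a b \<delta> \<sigma>) ((- b + s + 1) / (2 * a) + t / a) =
         t ^ 3 + (2 + s) * t\<^sup>2 - (1 - s) * t - 1"
proof -
  have d: "\<delta> = s\<^sup>2" using assms(2,3) by (auto simp: s_def)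
  \<comment> \<open>Odd powers of \<open>sqrt \<delta>\<close> occur in \<open>R_poly\<close> only
    together with the sign \<open>\<sigma>\<close>, so they become odd powers of
    \<open>s\<close>.\<close>
  have "\<sigma> * sqrt (\<delta> ^ 3) = \<delta> * s"
    using assms(2) by (simp add: s_def power3_eq_cube real_sqrt_mult)
  also have "\<dots> = s ^ 3"
    unfolding d by algebra
  finally have d3: "\<sigma> * sqrt (\<delta> ^ 3) = s ^ 3" .
  have d1: "\<sigma> * k * sqrt \<delta> = k * s" "\<sigma> * 2 * k * sqrt \<delta> = 2 * k * s" for k
    by (simp_all add: s_def)
  have R: "R_poly a b \<delta> \<sigma> =
     [:(s ^ 3 + (1 - b) * s\<^sup>2 - (b\<^sup>2 + 2 * b - 7) * s + b ^ 3 + b\<^sup>2 - 9 * b - 1) / (8 * a ^ 3),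
       (3 * b\<^sup>2 + 2 * b - 9 - s\<^sup>2 - 2 * (b + 1) * s) / (4 * a\<^sup>2), (3 * b + 1 - s) / (2 * a), 1:]"
    unfolding R_poly_def d3 d1 s_def[symmetric] d[symmetric] ..
  define m where "m = - b + s + 1 + 2 * t"
  have X: "(- b + s + 1) / (2 * a) + t / a = m / (2 * a)"
    using assms(1) by (simp add: m_def field_simps)
  have "8 * (a ^ 3 * poly (R_poly a b \<delta> \<sigma>) (m / (2 * a))) =
     (s ^ 3 + (1 - b) * s\<^sup>2 - (b\<^sup>2 + 2 * b - 7) * s + b ^ 3 + b\<^sup>2 - 9 * b - 1)
     + (3 * b\<^sup>2 + 2 * b - 9 - s\<^sup>2 - 2 * (b + 1) * s) * m + (3 * b + 1 - s) * m\<^sup>2 + m ^ 3"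
    unfolding R using assms(1) by (rule poly_cubic_rescaled)
  also have "\<dots> = 8 * (t ^ 3 + (2 + s) * t\<^sup>2 - (1 - s) * t - 1)"
    unfolding m_def by (simp add: algebra_simps power2_eq_square power3_eq_cube)
  finally show ?thesis unfolding X by (simp only: mult_cancel_left) simp
qed

text \<open>Multiplication by \<open>t ^ 3\<close> reverses the coefficients of
  \<open>Q_poly s\<close>; the cubic on the right is this reciprocal polynomial up to sign.\<close>

lemma poly_Q_poly_inverse_eq_0_iff:
  assumes "t \<noteq> 0"
  shows "poly (Q_poly s) (1 / t) = 0 \<longleftrightarrow> t ^ 3 + (2 + s) * t\<^sup>2 - (1 - s) * t - 1 = 0"
proof -
  have "t ^ 3 * poly (Q_poly s) (1 / t) = - (t ^ 3 + (2 + s) * t\<^sup>2 - (1 - s) * t - 1)"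
    using assms by (simp add: Q_poly_def field_simps power2_eq_square power3_eq_cube)
  then show ?thesis using assms
    by (metis mult_eq_0_iff neg_equal_0_iff_equal power_not_zero)
qed

lemma cycle_pts_formula_eq_roots:
  assumes "a \<noteq> 0" "\<delta> \<ge> 0" "\<sigma> = 1 \<or> \<sigma> = - 1"
  shows "cycle_pts_formula a b \<delta> \<sigma> = {x. poly (R_poly a b \<delta> \<sigma>) x = 0}"
proof -
  define s where "s = \<sigma> * sqrt \<delta>"
  define p where "p t = (- b + s + 1) / (2 * a) + t / a" for t
  define T where "T t = t ^ 3 + (2 + s) * t\<^sup>2 - (1 - s) * t - 1" for t
  have R: "poly (R_poly a b \<delta> \<sigma>) (p t) = 0 \<longleftrightarrow> T t = 0" for t
    using poly_R_poly_affine[OF assms, of b t] assms(1)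
    by (metis T_def p_def s_def mult_eq_0_iff power_not_zero)
  have Q: "poly (Q_poly s) (1 / t) = 0 \<longleftrightarrow> T t = 0" if "t \<noteq> 0" for t
    unfolding T_def using that by (rule poly_Q_poly_inverse_eq_0_iff)
  \<comment> \<open>Both constant terms are -1. This keeps the default value
    \<open>1 / 0 = 0\<close> out of the correspondence between \<open>u\<close> and
    \<open>t = 1 / u\<close>.\<close>
  have nz: "poly (Q_poly s) 0 \<noteq> 0" "T 0 \<noteq> 0" by (simp_all add: Q_poly_def T_def)
  \<comment> \<open>The preimage comes from solving the affine equation \<open>x = p t\<close> for
    \<open>t\<close>.\<close>
  have surj: "x = p (a * x - (- b + s + 1) / 2)" for x
    using assms(1) by (simp add: p_def field_simps)
  have pts: "cycle_pts_formula a b \<delta> \<sigma> = (\<lambda>u. p (1 / u)) ` {u. poly (Q_poly s) u = 0}"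
    unfolding cycle_pts_formula_eq_image p_def s_def by (simp add: mult.commute)
  show ?thesis unfolding pts
  proof (intro set_eqI iffI)
    fix x assume "x \<in> (\<lambda>u. p (1 / u)) ` {u. poly (Q_poly s) u = 0}"
    then obtain u where u: "x = p (1 / u)" "poly (Q_poly s) u = 0" by blast
    then have "u \<noteq> 0" using nz by auto
    then show "x \<in> {x. poly (R_poly a b \<delta> \<sigma>) x = 0}"
      using u Q[of "1 / u"] R[of "1 / u"] by simp
  next
    fix x assume x: "x \<in> {x. poly (R_poly a b \<delta> \<sigma>) x = 0}"
    obtain t where "x = p t" using surj by (rule that)
    then have t: "x = p t" "T t = 0" using x R by simp_all
    then have "t \<noteq> 0" using nz by auto
    then have "x = p (1 / (1 / t))" "poly (Q_poly s) (1 / t) = 0" using t Q by simp_all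
    then show "x \<in> (\<lambda>u. p (1 / u)) ` {u. poly (Q_poly s) u = 0}" by (intro image_eqI CollectI)
  qed
qed

theorem mainTheorem3:
  fixes a b c \<delta> :: real and g :: "real \<Rightarrow> real"
  assumes "a \<noteq> 0"
    and "\<And>x. g x = a * x\<^sup>2 + b * x + c"
    and "\<delta> = b\<^sup>2 - 4 * a * c - 2 * b - 7"
    and "\<delta> \<ge> 0"
  shows "cycle_points (C_cycle g a b \<delta> 1) = {x. poly (R_poly a b \<delta> 1) x = 0} \<and>
         cycle_points (C_cycle g a b \<delta> (- 1)) = {x. poly (R_poly a b \<delta> (- 1)) x = 0}"
proof -
  \<comment> \<open>Unique existence gives the definite description its defining property, so the
    point set of \<open>C_cycle\<close> is \<open>cycle_pts_formula\<close>.\<close>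
  have "cycle_points (C_cycle g a b \<delta> \<sigma>) = {x. poly (R_poly a b \<delta> \<sigma>) x = 0}"
    if "\<sigma> = 1 \<or> \<sigma> = - 1" for \<sigma>
    using theI'[OF C_cycle_well_defined[OF assms that]] cycle_pts_formula_eq_roots[OF assms(1,4) that]
    by (simp add: C_cycle_def)
  then show ?thesis by simp
qed

end
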